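(* Let $G_1,G_2,\ldots,G_t$ be mutually non-isomorphic connected finite simple graphs and let $m_1,m_2,\ldots,m_t$ be positive integers. Then $$\mathfrak{D}_k\Big(\bigcup_{i=1}^{t}m_iG_i\Big)=\prod_{i=1}^{t}\mathfrak{D}_k(m_iG_i)=\prod_{i=1}^{t}\prod_{j=0}^{m_i-1}\big(\mathfrak{D}_k(G_i)-j\,|\mathrm{Aut}(G_i)|\big).$$
   Context: For a finite simple graph $G$, a $k$-coloring is any map $c:V(G)\to\{1,\dots,k\}$; it is distinguishing if the only automorphism $f$ of $G$ with $c(f(v))=c(v)$ for all $v\in V(G)$ is the identity. $\mathfrak{D}_k(G)$ is the number of distinguishing maps $c:V(G)\to\{1,\dots,k\}$ (a polynomial in $k$, called the distinguishing polynomial of $G$). $mG$ denotes the disjoint union of $m$ copies of $G$, and $\bigcup$ denotes disjoint union of graphs. *)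

theory Defs
  imports
    Main
    "HOL-Library.FuncSet"
    "HOL-Combinatorics.Permutations"
    "Graph_Theory.Pair_Digraph"
    "Graph_Theory.Digraph_Component"
    "Graph_Theory.Digraph_Isomorphism"
begin

text \<open>
  A finite simple graph is a \<^locale>\<open>pair_graph\<close>: a finite vertex set with a symmetric,
  irreflexive set of arcs, each undirected edge being represented by its two orientations.
  The library's connectedness excludes the graph without vertices.
\<close>

text \<open>
  Automorphisms are represented by permutations of the vertex type that fix everything outside
  the vertex set, so that distinct elements are distinct automorphisms and \<^const>\<open>id\<close>
  is the identity automorphism.
\<close>

definition automorphisms :: "'a pair_pre_digraph \<Rightarrow> ('a \<Rightarrow> 'a) set" where
  "automorphisms G =
     {f. f permutes pverts G \<and>
         (\<forall>u\<in>pverts G. \<forall>v\<in>pverts G. (f u, f v) \<in> parcs G \<longleftrightarrow> (u, v) \<in> parcs G)}"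

definition distinguishing :: "'a pair_pre_digraph \<Rightarrow> ('a \<Rightarrow> 'c) \<Rightarrow> bool" where
  "distinguishing G c \<longleftrightarrow>
     (\<forall>f\<in>automorphisms G. (\<forall>v\<in>pverts G. c (f v) = c v) \<longrightarrow> f = id)"

text \<open>
  The value at \<open>k\<close> of the distinguishing polynomial. The colourings are extensional functions
  on the vertex set, so that each map from the vertex set is counted once.
\<close>

definition dist_poly :: "nat \<Rightarrow> 'a pair_pre_digraph \<Rightarrow> nat" where
  "dist_poly k G = card {c \<in> pverts G \<rightarrow>\<^sub>E {1..k}. distinguishing G c}"

definition disjoint_union ::
  "'i set \<Rightarrow> ('i \<Rightarrow> 'a pair_pre_digraph) \<Rightarrow> ('i \<times> 'a) pair_pre_digraph" where
  "disjoint_union I G =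
     \<lparr> pverts = (SIGMA i:I. pverts (G i)),
       parcs = {((i, u), (i, v)) | i u v. i \<in> I \<and> (u, v) \<in> parcs (G i)} \<rparr>"

definition copies :: "nat \<Rightarrow> 'a pair_pre_digraph \<Rightarrow> (nat \<times> 'a) pair_pre_digraph" where
  "copies m G = disjoint_union {..<m} (\<lambda>_. G)"

lemma pair_graph_disjoint_union:
  assumes "finite I" and G: "\<And>i. i \<in> I \<Longrightarrow> pair_graph (G i)"
  shows "pair_graph (disjoint_union I G)"
proof -
  have wf: "u \<in> pverts (G i) \<and> v \<in> pverts (G i) \<and> u \<noteq> v \<and> (v, u) \<in> parcs (G i)"
    if "i \<in> I" "(u, v) \<in> parcs (G i)" for i u v
  proof -
    interpret pair_graph "G i" using G that(1) .
    show ?thesis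
      using that(2) pair_no_loops[OF that(2)] arcs_symmetric[of u v] by (auto dest: wellformed')
  qed
  have fin: "finite (pverts (disjoint_union I G))"
    unfolding disjoint_union_def
    using assms pair_fin_digraph.pair_finite_verts pair_digraph_def pair_graph_def by fastforce
  have "parcs (disjoint_union I G)
      \<subseteq> pverts (disjoint_union I G) \<times> pverts (disjoint_union I G)"
    using wf by (fastforce simp: disjoint_union_def)
  then have "finite (parcs (disjoint_union I G))"
    using fin finite_subset by blast
  with fin show ?thesis
    by unfold_locales
      (use wf in \<open>fastforce simp: disjoint_union_def symmetric_def intro!: symI\<close>)+
qed

end

theory Submission
  imports Defs
begin

text \<open>
  An automorphism of a disjoint union of connected graphs carries each component isomorphically
  onto a component. So a colouring of the union is distinguishing iff it is distinguishing on each
  component and no two components are isomorphic as coloured graphs; the second condition is only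
  felt between isomorphic components, which gives the product over \<open>i\<close>. The group
  \<open>Aut(G)\<close> acts freely on the distinguishing colourings of \<open>G\<close>, with the classes of isomorphic
  colourings as orbits, so after choosing colourings for \<open>j\<close> copies, the next copy must avoid \<open>j\<close>
  disjoint orbits of size \<open>|Aut(G)|\<close> each.
\<close>

section \<open>Isomorphisms of graphs and of coloured graphs\<close>

text \<open>Values outside \<open>pverts G\<close> are left free, so that isomorphisms between
  different graphs, possibly over different vertex types, can be restricted, inverted and composed
  without extending them to the whole type.\<close>

definition graph_iso :: "('a \<Rightarrow> 'b) \<Rightarrow> 'a pair_pre_digraph \<Rightarrow> 'b pair_pre_digraph \<Rightarrow> bool" where
  "graph_iso g G H \<longleftrightarrow> bij_betw g (pverts G) (pverts H) \<and>
     (\<forall>u\<in>pverts G. \<forall>v\<in>pverts G. (g u, g v) \<in> parcs H \<longleftrightarrow> (u, v) \<in> parcs G)"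

definition colour_isomorphic ::
  "'a pair_pre_digraph \<Rightarrow> ('a \<Rightarrow> 'c) \<Rightarrow> 'b pair_pre_digraph \<Rightarrow> ('b \<Rightarrow> 'c) \<Rightarrow> bool" where
  "colour_isomorphic G c H d \<longleftrightarrow> (\<exists>g. graph_iso g G H \<and> (\<forall>v\<in>pverts G. d (g v) = c v))"

lemma graph_iso_in_pverts: "graph_iso g G H \<Longrightarrow> v \<in> pverts G \<Longrightarrow> g v \<in> pverts H"
  by (auto simp: graph_iso_def bij_betw_def)

lemma graph_iso_inj_on: "graph_iso g G H \<Longrightarrow> inj_on g (pverts G)"
  by (simp add: graph_iso_def bij_betw_def)

lemma graph_iso_arc_iff:
  "graph_iso g G H \<Longrightarrow> u \<in> pverts G \<Longrightarrow> v \<in> pverts G \<Longrightarrow>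
     (g u, g v) \<in> parcs H \<longleftrightarrow> (u, v) \<in> parcs G"
  by (simp add: graph_iso_def)

lemma graph_iso_id: "graph_iso id G G"
  by (simp add: graph_iso_def)

lemma graph_iso_comp:
  assumes "graph_iso g G H" "graph_iso h H K"
  shows "graph_iso (h \<circ> g) G K"
  using assms graph_iso_in_pverts[OF assms(1)]
  by (auto simp: graph_iso_def intro: bij_betw_trans)

lemma graph_iso_inv_into:
  assumes g: "graph_iso g G H"
  shows "graph_iso (inv_into (pverts G) g) H G"
proof -
  have b: "bij_betw g (pverts G) (pverts H)" using g by (simp add: graph_iso_def)
  have "(inv_into (pverts G) g u, inv_into (pverts G) g v) \<in> parcs G \<longleftrightarrow> (u, v) \<in> parcs H"
    if "u \<in> pverts H" "v \<in> pverts H" for u v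
    using graph_iso_arc_iff[OF g, of "inv_into (pverts G) g u" "inv_into (pverts G) g v"]
      that b by (simp add: bij_betw_inv_into_right bij_betw_def inv_into_into)
  then show ?thesis using bij_betw_inv_into[OF b] by (simp add: graph_iso_def)
qed

lemma automorphism_iff: "f \<in> automorphisms G \<longleftrightarrow> f permutes pverts G \<and> graph_iso f G G"
  by (auto simp: automorphisms_def graph_iso_def permutes_imp_bij)

text \<open>Replacing \<open>g\<close> by the identity off the vertex set meets the normalisation
  built into \<open>automorphisms\<close> and keeps its values on vertices.\<close>

lemma graph_iso_extends_to_automorphism:
  assumes g: "graph_iso g G G"
  obtains f where "f \<in> automorphisms G" "\<And>v. v \<in> pverts G \<Longrightarrow> f v = g v"
proof -
  let ?f = "\<lambda>v. if v \<in> pverts G then g v else v"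
  have "bij_betw ?f (pverts G) (pverts G)"
    using g bij_betw_cong[of "pverts G" ?f g] by (simp add: graph_iso_def)
  then have "?f permutes pverts G" by (rule bij_imp_permutes) simp
  moreover from this have "graph_iso ?f G G"
    using g by (simp add: graph_iso_def permutes_imp_bij)
  ultimately show thesis using that[of ?f] by (simp add: automorphism_iff)
qed

text \<open>Removes the normalisation outside the vertex set from the notion, so that maps assembled
  from several components can be tested directly.\<close>

lemma distinguishing_iff_graph_iso:
  "distinguishing G c \<longleftrightarrow>
     (\<forall>g. graph_iso g G G \<longrightarrow> (\<forall>v\<in>pverts G. c (g v) = c v) \<longrightarrow> (\<forall>v\<in>pverts G. g v = v))"
  (is "_ \<longleftrightarrow> ?R")
proof
  assume d: "distinguishing G c"
  show ?R
  proof (intro allI impI ballI)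
    fix g v
    assume g: "graph_iso g G G" and c: "\<forall>v\<in>pverts G. c (g v) = c v" and v: "v \<in> pverts G"
    obtain f where f: "f \<in> automorphisms G" "\<And>v. v \<in> pverts G \<Longrightarrow> f v = g v"
      using graph_iso_extends_to_automorphism[OF g] by blast
    then have "f = id" using d c by (simp add: distinguishing_def)
    then show "g v = v" using f(2)[OF v] by simp
  qed
next
  assume R: ?R
  show "distinguishing G c"
    unfolding distinguishing_def
  proof (intro ballI impI)
    fix f
    assume f: "f \<in> automorphisms G" and c: "\<forall>v\<in>pverts G. c (f v) = c v"
    then have "f v = v" if "v \<in> pverts G" for v using R that by (simp add: automorphism_iff)
    moreover have "f v = v" if "v \<notin> pverts G" for v
      using f that by (auto simp: automorphism_iff dest: permutes_not_in)
    ultimately show "f = id" by (metis eq_id_iff)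
  qed
qed

text \<open>Needed because the colourings counted are extensional, whereas slices such as
  \<open>\<lambda>v. c (i, v)\<close> are not; both agree on vertices.\<close>

lemma distinguishing_cong:
  assumes "\<And>v. v \<in> pverts G \<Longrightarrow> c v = d v"
  shows "distinguishing G c \<longleftrightarrow> distinguishing G d"
  unfolding distinguishing_iff_graph_iso
  using assms by (metis graph_iso_in_pverts)

lemma colour_isomorphic_cong:
  assumes "\<And>v. v \<in> pverts G \<Longrightarrow> c v = c' v" "\<And>v. v \<in> pverts H \<Longrightarrow> d v = d' v"
  shows "colour_isomorphic G c H d \<longleftrightarrow> colour_isomorphic G c' H d'"
  unfolding colour_isomorphic_def
  using assms by (metis graph_iso_in_pverts)

lemma colour_isomorphic_refl: "colour_isomorphic G c G c"
  unfolding colour_isomorphic_def using graph_iso_id by fastforce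

lemma colour_isomorphic_sym:
  assumes "colour_isomorphic G c H d"
  shows "colour_isomorphic H d G c"
proof -
  obtain g where g: "graph_iso g G H" and c: "\<forall>v\<in>pverts G. d (g v) = c v"
    using assms by (auto simp: colour_isomorphic_def)
  have "c (inv_into (pverts G) g w) = d w" if "w \<in> pverts H" for w
    using c g that by (metis bij_betw_def f_inv_into_f graph_iso_def inv_into_into)
  then show ?thesis
    using graph_iso_inv_into[OF g] by (auto simp: colour_isomorphic_def)
qed

lemma colour_isomorphic_trans:
  assumes "colour_isomorphic G c H d" "colour_isomorphic H d K e"
  shows "colour_isomorphic G c K e"
proof -
  obtain g h where gh: "graph_iso g G H" "graph_iso h H K"
    and c: "\<forall>v\<in>pverts G. d (g v) = c v" "\<forall>v\<in>pverts H. e (h v) = d v"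
    using assms by (auto simp: colour_isomorphic_def)
  have "\<forall>v\<in>pverts G. e ((h \<circ> g) v) = c v"
    using c graph_iso_in_pverts[OF gh(1)] by simp
  then show ?thesis using graph_iso_comp[OF gh] by (auto simp: colour_isomorphic_def)
qed

text \<open>Conjugation by the isomorphism \<open>g\<close> turns a colour-preserving automorphism
  \<open>f\<close> of \<open>G\<close> into one of \<open>H\<close>, which is trivial on vertices;
  hence so is \<open>f\<close>.\<close>

lemma colour_isomorphic_distinguishing:
  assumes iso: "colour_isomorphic G c H d" and d: "distinguishing H d"
  shows "distinguishing G c"
  unfolding distinguishing_iff_graph_iso
proof (intro allI impI ballI)
  fix f v
  assume f: "graph_iso f G G" and cf: "\<forall>v\<in>pverts G. c (f v) = c v" and v: "v \<in> pverts G"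
  obtain g where g: "graph_iso g G H" and c: "\<forall>v\<in>pverts G. d (g v) = c v"
    using iso by (auto simp: colour_isomorphic_def)
  let ?g' = "inv_into (pverts G) g"
  have g': "graph_iso ?g' H G" using g by (rule graph_iso_inv_into)
  have gg': "g (?g' w) = w" if "w \<in> pverts H" for w
    using g that unfolding graph_iso_def by (blast intro: bij_betw_inv_into_right)
  have g'g: "?g' (g v) = v" using g v unfolding graph_iso_def by (blast intro: bij_betw_inv_into_left)
  let ?h = "g \<circ> (f \<circ> ?g')"
  have "graph_iso ?h H H" by (rule graph_iso_comp[OF graph_iso_comp[OF g' f] g])
  moreover have "\<forall>w\<in>pverts H. d (?h w) = d w"
    using c cf gg' graph_iso_in_pverts[OF g'] graph_iso_in_pverts[OF f] by (metis comp_apply)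
  ultimately have "?h (g v) = g v"
    using d graph_iso_in_pverts[OF g v] unfolding distinguishing_iff_graph_iso by blast
  then have "g (f v) = g v" using g'g by simp
  then show "f v = v"
    using graph_iso_inj_on[OF g] graph_iso_in_pverts[OF f v] v by (simp add: inj_on_eq_iff)
qed

text \<open>Used in contrapositive form: non-isomorphism is assumed for the library's digraphs,
  which carry explicit arcs, and is needed for \<open>graph_iso\<close>.\<close>

lemma graph_iso_imp_digraph_iso:
  assumes "pair_graph G" "pair_graph H" and g: "graph_iso g G H"
  shows "digraph_iso (with_proj G) (with_proj H)"
proof -
  interpret G: pair_graph G by fact
  interpret H: pair_graph H by fact
  \<comment> \<open>Arcs are pairs of vertices, so the arc map applies \<open>g\<close> to both
    endpoints, and tail and head remain the two projections.\<close>
  let ?hom = "\<lparr>iso_verts = g, iso_arcs = map_prod g g, iso_head = snd, iso_tail = fst\<rparr>"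
  have inj: "inj_on g (pverts G)" and im: "g ` pverts G = pverts H"
    using g by (auto simp: graph_iso_def bij_betw_def)
  have "inj_on (map_prod g g) (parcs G)"
    by (rule inj_on_subset[OF map_prod_inj_on[OF inj inj]]) (auto dest: G.wellformed')
  then have "pre_digraph.digraph_isomorphism (with_proj G) ?hom"
    using inj G.wf_digraph_axioms by (simp add: pre_digraph.digraph_isomorphism_def)
  moreover have "map_prod g g ` parcs G = parcs H"
  proof
    show "map_prod g g ` parcs G \<subseteq> parcs H"
      using graph_iso_arc_iff[OF g] by (auto dest: G.wellformed')
    show "parcs H \<subseteq> map_prod g g ` parcs G"
    proof
      fix e assume e: "e \<in> parcs H"
      obtain a b where ab: "e = (a, b)" by (cases e)
      then have "a \<in> g ` pverts G" "b \<in> g ` pverts G"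
        using e im H.wellformed' by auto
      then obtain u v where uv: "u \<in> pverts G" "v \<in> pverts G" "a = g u" "b = g v" by blast
      then have "(u, v) \<in> parcs G" using e ab graph_iso_arc_iff[OF g] by simp
      then show "e \<in> map_prod g g ` parcs G" using ab uv by force
    qed
  qed
  then have "with_proj H = app_iso ?hom (with_proj G)"
    using im by (simp add: app_iso_def with_proj_def)
  ultimately show ?thesis unfolding digraph_iso_def by blast
qed

section \<open>Automorphisms of a graph split into connected components\<close>

text \<open>Follow a path from a vertex of \<open>A\<close>. Paths run in the symmetric closure of
  the arcs, hence the closure hypothesis covers both directions.\<close>

lemma connected_closed_set:
  assumes conn: "Digraph_Component.connected (with_proj G)"
    and A: "A \<subseteq> pverts G" "A \<noteq> {}"
    and closed: "\<And>u v. u \<in> A \<Longrightarrow> v \<in> pverts G \<Longrightarrow> (u, v) \<in> parcs G \<or> (v, u) \<in> parcs G \<Longrightarrow> v \<in> A"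
  shows "A = pverts G"
proof -
  obtain u where u: "u \<in> A" using A by blast
  have "v \<in> A" if v: "v \<in> pverts G" for v
  proof -
    have "(u, v) \<in> rtrancl_on (pverts G) (parcs (mk_symmetric (with_proj G)))"
      using conn u v A by (auto simp: connected_def strongly_connected_def reachable_def)
    then show ?thesis
      by (induction rule: rtrancl_on_induct) (use u closed in \<open>auto simp: parcs_mk_symmetric\<close>)
  qed
  then show ?thesis using A by blast
qed

lemma connected_pverts_nonempty:
  "Digraph_Component.connected (with_proj G) \<Longrightarrow> pverts G \<noteq> {}"
  by (simp add: connected_def strongly_connected_def)

text \<open>
  The embeddings \<open>emb j\<close> let one argument cover both the copies of a single graph and the nested
  union of copies, whose components are indexed by pairs.
\<close>

locale component_decomposition =
  fixes X :: "'b pair_pre_digraph" and J :: "'j set"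
    and H :: "'j \<Rightarrow> 'a pair_pre_digraph" and emb :: "'j \<Rightarrow> 'a \<Rightarrow> 'b"
  assumes emb_inj: "\<And>i j u v. i \<in> J \<Longrightarrow> j \<in> J \<Longrightarrow> u \<in> pverts (H i) \<Longrightarrow> v \<in> pverts (H j) \<Longrightarrow>
      emb i u = emb j v \<Longrightarrow> i = j \<and> u = v"
    and pverts_eq: "pverts X = (\<Union>j\<in>J. emb j ` pverts (H j))"
    and arc_iff: "\<And>i j u v. i \<in> J \<Longrightarrow> j \<in> J \<Longrightarrow> u \<in> pverts (H i) \<Longrightarrow> v \<in> pverts (H j) \<Longrightarrow>
      (emb i u, emb j v) \<in> parcs X \<longleftrightarrow> i = j \<and> (u, v) \<in> parcs (H i)"
    and connected: "\<And>j. j \<in> J \<Longrightarrow> Digraph_Component.connected (with_proj (H j))"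
begin

lemma pvertsE:
  assumes "x \<in> pverts X"
  obtains j v where "j \<in> J" "v \<in> pverts (H j)" "x = emb j v"
  using assms unfolding pverts_eq by blast

lemma emb_in_pverts: "j \<in> J \<Longrightarrow> v \<in> pverts (H j) \<Longrightarrow> emb j v \<in> pverts X"
  unfolding pverts_eq by blast

text \<open>Fix the component \<open>j\<close> that receives one chosen vertex. The vertices of
  component \<open>i\<close> sent into \<open>j\<close> are closed under adjacency, since arcs of
  \<open>X\<close> never join different components; by connectedness they are all of component
  \<open>i\<close>.\<close>

lemma component_into_component:
  assumes f: "graph_iso f X X" and i: "i \<in> J"
  obtains j where "j \<in> J" "f ` emb i ` pverts (H i) \<subseteq> emb j ` pverts (H j)"
proof -
  obtain u where u: "u \<in> pverts (H i)" using connected_pverts_nonempty[OF connected[OF i]] by blast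
  obtain j w where j: "j \<in> J" "w \<in> pverts (H j)" "f (emb i u) = emb j w"
    using pvertsE graph_iso_in_pverts[OF f emb_in_pverts[OF i u]] by metis
  let ?A = "{v \<in> pverts (H i). f (emb i v) \<in> emb j ` pverts (H j)}"
  have "?A = pverts (H i)"
  proof (rule connected_closed_set[OF connected[OF i]])
    show "?A \<noteq> {}" using u j by blast
  next
    fix v v'
    assume v: "v \<in> ?A" and v': "v' \<in> pverts (H i)"
      and arc: "(v, v') \<in> parcs (H i) \<or> (v', v) \<in> parcs (H i)"
    obtain x where x: "x \<in> pverts (H j)" "f (emb i v) = emb j x" using v by blast
    obtain l y where y: "l \<in> J" "y \<in> pverts (H l)" "f (emb i v') = emb l y"
      using pvertsE graph_iso_in_pverts[OF f emb_in_pverts[OF i v']] by metis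
    have "(emb i v, emb i v') \<in> parcs X \<or> (emb i v', emb i v) \<in> parcs X"
      using arc i v v' by (simp add: arc_iff)
    then have "(emb j x, emb l y) \<in> parcs X \<or> (emb l y, emb j x) \<in> parcs X"
      using graph_iso_arc_iff[OF f] i v v' emb_in_pverts x y by (metis (no_types, lifting) mem_Collect_eq)
    then have "l = j" using arc_iff j(1) x y by metis
    then show "v' \<in> ?A" using v' y by blast
  qed blast
  then show thesis using that j(1) by blast
qed

text \<open>The inverse of \<open>f\<close> also maps component \<open>j\<close> into a single
  component \<open>l\<close>. It brings the image of a vertex of component \<open>i\<close> back to
  that vertex, so \<open>l = i\<close>, and the inclusion becomes an equality.\<close>

lemma component_onto_component:
  assumes f: "graph_iso f X X" and i: "i \<in> J"
  obtains j where "j \<in> J" "f ` emb i ` pverts (H i) = emb j ` pverts (H j)"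
proof -
  obtain j where j: "j \<in> J" "f ` emb i ` pverts (H i) \<subseteq> emb j ` pverts (H j)"
    using component_into_component[OF f i] by blast
  let ?f' = "inv_into (pverts X) f"
  obtain l where l: "l \<in> J" "?f' ` emb j ` pverts (H j) \<subseteq> emb l ` pverts (H l)"
    using component_into_component[OF graph_iso_inv_into[OF f] j(1)] by blast
  obtain u where u: "u \<in> pverts (H i)" using connected_pverts_nonempty[OF connected[OF i]] by blast
  have bij: "bij_betw f (pverts X) (pverts X)" using f by (simp add: graph_iso_def)
  have "?f' (f (emb i u)) = emb i u"
    using bij_betw_inv_into_left[OF bij] emb_in_pverts[OF i u] by simp
  then have "emb i u \<in> emb l ` pverts (H l)" using u j l by (metis image_eqI image_subset_iff)
  then have "l = i" using emb_inj i l(1) u by blast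
  have "emb j w \<in> f ` emb i ` pverts (H i)" if w: "w \<in> pverts (H j)" for w
    using bij_betw_inv_into_right[OF bij emb_in_pverts[OF j(1) w]] l(2) w \<open>l = i\<close>
    by (metis image_eqI image_subset_iff)
  then show thesis using that j by blast
qed

lemma automorphism_on_component:
  assumes f: "graph_iso f X X" and i: "i \<in> J"
  obtains j g where "j \<in> J" "graph_iso g (H i) (H j)"
    "\<And>v. v \<in> pverts (H i) \<Longrightarrow> f (emb i v) = emb j (g v)"
proof -
  obtain j where j: "j \<in> J" "f ` emb i ` pverts (H i) = emb j ` pverts (H j)"
    using component_onto_component[OF f i] by blast
  \<comment> \<open>\<open>g\<close> is \<open>f\<close> read in the coordinates of the two
    components: embed by \<open>emb i\<close>, apply \<open>f\<close>, undo
    \<open>emb j\<close>.\<close>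
  define g where "g v = inv_into (pverts (H j)) (emb j) (f (emb i v))" for v
  have g: "g v \<in> pverts (H j)" "emb j (g v) = f (emb i v)" if v: "v \<in> pverts (H i)" for v
  proof -
    have "f (emb i v) \<in> emb j ` pverts (H j)" using j v by blast
    then show "g v \<in> pverts (H j)" "emb j (g v) = f (emb i v)"
      unfolding g_def by (rule inv_into_into, rule f_inv_into_f)
  qed
  have "inj_on g (pverts (H i))"
  proof (rule inj_onI)
    fix u v assume uv: "u \<in> pverts (H i)" "v \<in> pverts (H i)" "g u = g v"
    then have "f (emb i u) = f (emb i v)" using g(2) by metis
    then have "emb i u = emb i v"
      using graph_iso_inj_on[OF f] emb_in_pverts[OF i] uv by (simp add: inj_on_eq_iff)
    then show "u = v" using emb_inj i uv by blast
  qed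
  moreover have "w \<in> g ` pverts (H i)" if w: "w \<in> pverts (H j)" for w
  proof -
    obtain v where v: "v \<in> pverts (H i)" "f (emb i v) = emb j w" using j w by force
    then have "g v = w" using g[OF v(1)] emb_inj j(1) w by metis
    then show ?thesis using v by blast
  qed
  moreover have "(g u, g v) \<in> parcs (H j) \<longleftrightarrow> (u, v) \<in> parcs (H i)"
    if uv: "u \<in> pverts (H i)" "v \<in> pverts (H i)" for u v
  proof -
    have "(g u, g v) \<in> parcs (H j) \<longleftrightarrow> (emb j (g u), emb j (g v)) \<in> parcs X"
      using arc_iff[OF j(1) j(1) g(1)[OF uv(1)] g(1)[OF uv(2)]] by simp
    also have "\<dots> \<longleftrightarrow> (emb i u, emb i v) \<in> parcs X"
      using g(2) uv graph_iso_arc_iff[OF f] emb_in_pverts[OF i] by simp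
    also have "\<dots> \<longleftrightarrow> (u, v) \<in> parcs (H i)" using arc_iff i uv by simp
    finally show ?thesis .
  qed
  ultimately have "graph_iso g (H i) (H j)"
    unfolding graph_iso_def bij_betw_def using g(1) by blast
  then show thesis using that j(1) g(2) by metis
qed

text \<open>Converse direction: a permutation \<open>p\<close> of the components with isomorphisms
  along it glues to an automorphism of \<open>X\<close>.\<close>

lemma automorphism_from_components:
  assumes p: "bij_betw p J J"
    and g: "\<And>i. i \<in> J \<Longrightarrow> graph_iso (g i) (H i) (H (p i))"
  obtains f where "graph_iso f X X"
    "\<And>i v. i \<in> J \<Longrightarrow> v \<in> pverts (H i) \<Longrightarrow> f (emb i v) = emb (p i) (g i v)"
proof -
  let ?S = "SIGMA j:J. pverts (H j)"
  let ?e = "\<lambda>(j, v). emb j v"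
  define f where "f x = (case inv_into ?S ?e x of (j, v) \<Rightarrow> emb (p j) (g j v))" for x
  have inj: "inj_on ?e ?S" by (rule inj_onI) (use emb_inj in fastforce)
  have f: "f (emb i v) = emb (p i) (g i v)" if "i \<in> J" "v \<in> pverts (H i)" for i v
    using inv_into_f_f[OF inj, of "(i, v)"] that by (simp add: f_def)
  have pJ: "p i \<in> J" if "i \<in> J" for i using p that by (auto simp: bij_betw_def)
  have gV: "g i v \<in> pverts (H (p i))" if "i \<in> J" "v \<in> pverts (H i)" for i v
    using graph_iso_in_pverts[OF g] that by blast
  have "inj_on f (pverts X)"
  proof (rule inj_onI)
    fix x y assume xy: "x \<in> pverts X" "y \<in> pverts X" "f x = f y"
    obtain i u where u: "i \<in> J" "u \<in> pverts (H i)" "x = emb i u" using xy pvertsE by metis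
    obtain j v where v: "j \<in> J" "v \<in> pverts (H j)" "y = emb j v" using xy pvertsE by metis
    have "emb (p i) (g i u) = emb (p j) (g j v)" using xy u v f by simp
    then have eq: "p i = p j \<and> g i u = g j v" using emb_inj pJ gV u v by blast
    then have "i = j" using p u v by (auto simp: bij_betw_def inj_on_def)
    then have "u = v" using eq graph_iso_inj_on[OF g[OF u(1)]] u v by (simp add: inj_on_eq_iff)
    then show "x = y" using \<open>i = j\<close> u v by simp
  qed
  moreover have "f ` pverts X \<subseteq> pverts X"
    using f pJ gV emb_in_pverts by (fastforce elim: pvertsE)
  moreover have "pverts X \<subseteq> f ` pverts X"
  proof
    fix x assume "x \<in> pverts X"
    then obtain j w where w: "j \<in> J" "w \<in> pverts (H j)" "x = emb j w" by (rule pvertsE)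
    then obtain i where i: "i \<in> J" "j = p i" using p by (auto simp: bij_betw_def)
    then obtain v where v: "v \<in> pverts (H i)" "w = g i v"
      using g[OF i(1)] w unfolding graph_iso_def bij_betw_def by blast
    have "x = f (emb i v)" using f i v w by simp
    then show "x \<in> f ` pverts X" using emb_in_pverts i v by blast
  qed
  moreover have "(f x, f y) \<in> parcs X \<longleftrightarrow> (x, y) \<in> parcs X"
    if xy: "x \<in> pverts X" "y \<in> pverts X" for x y
  proof -
    obtain i u where u: "i \<in> J" "u \<in> pverts (H i)" "x = emb i u" using xy pvertsE by metis
    obtain j v where v: "j \<in> J" "v \<in> pverts (H j)" "y = emb j v" using xy pvertsE by metis
    have "(f x, f y) \<in> parcs X \<longleftrightarrow> p i = p j \<and> (g i u, g j v) \<in> parcs (H (p i))"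
      using u v f arc_iff pJ gV by simp
    also have "\<dots> \<longleftrightarrow> i = j \<and> (g i u, g j v) \<in> parcs (H (p i))"
      using p u v by (auto simp: bij_betw_def inj_on_def)
    also have "\<dots> \<longleftrightarrow> i = j \<and> (u, v) \<in> parcs (H i)"
      using graph_iso_arc_iff[OF g] u v by blast
    also have "\<dots> \<longleftrightarrow> (x, y) \<in> parcs X" using u v arc_iff by simp
    finally show ?thesis .
  qed
  ultimately have "graph_iso f X X" unfolding graph_iso_def bij_betw_def by blast
  then show thesis using that f by blast
qed

lemma distinguishing_iff:
  "distinguishing X c \<longleftrightarrow>
     (\<forall>j\<in>J. distinguishing (H j) (c \<circ> emb j)) \<and>
     (\<forall>i\<in>J. \<forall>j\<in>J. i \<noteq> j \<longrightarrow> \<not> colour_isomorphic (H i) (c \<circ> emb i) (H j) (c \<circ> emb j))"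
  (is "_ \<longleftrightarrow> ?D \<and> ?N")
proof (intro iffI conjI)
  assume X: "distinguishing X c"
  \<comment> \<open>Both necessary conditions come from this: a glued automorphism that preserves
    colours must be trivial in \<open>p\<close> and in every \<open>g i\<close>. It is applied with
    \<open>p\<close> the identity and with \<open>p\<close> a transposition.\<close>
  have fix_all: "p i = i \<and> g i v = v"
    if p: "bij_betw p J J" and g: "\<And>i. i \<in> J \<Longrightarrow> graph_iso (g i) (H i) (H (p i))"
      and c: "\<And>i v. i \<in> J \<Longrightarrow> v \<in> pverts (H i) \<Longrightarrow> c (emb (p i) (g i v)) = c (emb i v)"
      and i: "i \<in> J" and v: "v \<in> pverts (H i)" for p g i v
  proof -
    obtain f where f: "graph_iso f X X"
      "\<And>i v. i \<in> J \<Longrightarrow> v \<in> pverts (H i) \<Longrightarrow> f (emb i v) = emb (p i) (g i v)"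
      using automorphism_from_components[of p g] p g by blast
    have "\<forall>x\<in>pverts X. c (f x) = c x" using c f(2) by (auto elim: pvertsE)
    then have "emb (p i) (g i v) = emb i v"
      using X f(1) emb_in_pverts[OF i v] f(2)[OF i v] unfolding distinguishing_iff_graph_iso
      by metis
    moreover have "p i \<in> J" using p i by (auto simp: bij_betw_def)
    ultimately show ?thesis
      using emb_inj i v graph_iso_in_pverts[OF g[OF i] v] by blast
  qed
  show ?D
    unfolding distinguishing_iff_graph_iso
  proof (intro ballI allI impI)
    fix j h v
    assume j: "j \<in> J" and h: "graph_iso h (H j) (H j)"
      and c: "\<forall>v\<in>pverts (H j). (c \<circ> emb j) (h v) = (c \<circ> emb j) v" and v: "v \<in> pverts (H j)"
    \<comment> \<open>Let \<open>h\<close> act on component \<open>j\<close> and the identity on all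
      others.\<close>
    have "id j = j \<and> ((\<lambda>_. id)(j := h)) j v = v"
      by (rule fix_all[where p = id and g = "(\<lambda>_. id)(j := h)"])
        (use j h c v graph_iso_id in auto)
    then show "h v = v" by simp
  qed
  show ?N
  proof (intro ballI impI notI)
    fix i j
    assume ij: "i \<in> J" "j \<in> J" "i \<noteq> j"
      and "colour_isomorphic (H i) (c \<circ> emb i) (H j) (c \<circ> emb j)"
    then obtain h where h: "graph_iso h (H i) (H j)"
      and c: "\<And>v. v \<in> pverts (H i) \<Longrightarrow> c (emb j (h v)) = c (emb i v)"
      by (auto simp: colour_isomorphic_def)
    let ?h' = "inv_into (pverts (H i)) h"
    have bij: "bij_betw h (pverts (H i)) (pverts (H j))" using h by (simp add: graph_iso_def)
    have h': "graph_iso ?h' (H j) (H i)" by (rule graph_iso_inv_into[OF h])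
    have c': "c (emb i (?h' w)) = c (emb j w)" if "w \<in> pverts (H j)" for w
      using c[OF graph_iso_in_pverts[OF h' that]] bij_betw_inv_into_right[OF bij that] by simp
    \<comment> \<open>Exchange components \<open>i\<close> and \<open>j\<close> by \<open>h\<close>
      and its inverse and leave the rest alone. This preserves colours, so \<open>fix_all\<close>
      would make the transposition fix \<open>i\<close>.\<close>
    let ?p = "transpose i j"
    let ?g = "(\<lambda>_. id)(i := h, j := ?h')"
    \<comment> \<open>A connected graph has a vertex; on empty components the exchange would move
      nothing and give no contradiction.\<close>
    obtain v where v: "v \<in> pverts (H i)"
      using connected_pverts_nonempty[OF connected[OF ij(1)]] by blast
    have g: "graph_iso (?g l) (H l) (H (?p l))" for l
      using h h' ij(3) graph_iso_id[of "H l"] by (cases "l = i"; cases "l = j"; simp)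
    have cg: "c (emb (?p l) (?g l w)) = c (emb l w)" if "w \<in> pverts (H l)" for l w
      using c c' ij(3) that by (cases "l = i"; cases "l = j"; simp)
    have "bij_betw ?p J J"
      by (rule permutes_imp_bij, rule permutes_swap_id[OF ij(1,2)])
    then have "?p i = i \<and> ?g i v = v"
      using fix_all[of ?p ?g i v] g cg ij(1) v by blast
    then show False using ij(3) by simp
  qed
next
  assume DN: "?D \<and> ?N"
  show "distinguishing X c"
    unfolding distinguishing_iff_graph_iso
  proof (intro allI impI ballI)
    fix f x
    assume f: "graph_iso f X X" and c: "\<forall>x\<in>pverts X. c (f x) = c x" and "x \<in> pverts X"
    then obtain i v where v: "i \<in> J" "v \<in> pverts (H i)" "x = emb i v" by (metis pvertsE)
    obtain j g where j: "j \<in> J" and g: "graph_iso g (H i) (H j)"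
      "\<And>v. v \<in> pverts (H i) \<Longrightarrow> f (emb i v) = emb j (g v)"
      using automorphism_on_component[OF f v(1)] by blast
    have cg: "(c \<circ> emb j) (g v) = (c \<circ> emb i) v" if "v \<in> pverts (H i)" for v
      using c g(2)[OF that] emb_in_pverts[OF v(1) that] by (metis comp_apply)
    then have "colour_isomorphic (H i) (c \<circ> emb i) (H j) (c \<circ> emb j)"
      using g(1) unfolding colour_isomorphic_def by blast
    \<comment> \<open>A colour-preserving \<open>f\<close> makes components \<open>i\<close> and
      \<open>j\<close> isomorphic as coloured graphs, so it cannot change the component; being
      distinguishing on component \<open>i\<close> then makes it trivial there.\<close>
    then have "j = i" using DN v(1) j by metis
    then have "g v = v"
      using DN v(1,2) g(1) cg unfolding distinguishing_iff_graph_iso by blast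
    then show "f x = x" using g(2) v \<open>j = i\<close> by simp
  qed
qed

end

section \<open>Distinguishing colourings of disjoint unions and of copies\<close>

lemma pverts_disjoint_union: "pverts (disjoint_union I G) = (SIGMA i:I. pverts (G i))"
  by (simp add: disjoint_union_def)

lemma parcs_disjoint_union_iff:
  "((i, u), (j, v)) \<in> parcs (disjoint_union I G) \<longleftrightarrow> i \<in> I \<and> i = j \<and> (u, v) \<in> parcs (G i)"
  by (auto simp: disjoint_union_def)

lemma component_decomposition_copies:
  assumes "Digraph_Component.connected (with_proj G)"
  shows "component_decomposition (copies m G) {..<m} (\<lambda>_. G) Pair"
  by standard
    (use assms in \<open>auto simp: copies_def pverts_disjoint_union parcs_disjoint_union_iff\<close>)

lemma component_decomposition_union_copies:
  assumes "\<And>i. i \<in> I \<Longrightarrow> Digraph_Component.connected (with_proj (G i))"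
  shows "component_decomposition (disjoint_union I (\<lambda>i. copies (m i) (G i)))
    (SIGMA i:I. {..<m i}) (\<lambda>(i, j). G i) (\<lambda>(i, j) v. (i, j, v))"
  by standard
    (use assms in \<open>auto simp: copies_def pverts_disjoint_union parcs_disjoint_union_iff\<close>)+

lemma distinguishing_copies_iff:
  assumes "Digraph_Component.connected (with_proj G)"
  shows "distinguishing (copies m G) c \<longleftrightarrow>
    (\<forall>j<m. distinguishing G (\<lambda>v. c (j, v))) \<and>
    (\<forall>i<m. \<forall>j<m. i \<noteq> j \<longrightarrow> \<not> colour_isomorphic G (\<lambda>v. c (i, v)) G (\<lambda>v. c (j, v)))"
  using component_decomposition.distinguishing_iff[OF component_decomposition_copies[OF assms]]
  by (simp add: comp_def Ball_def)

text \<open>Components with different first index are not even isomorphic as graphs, so only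
  comparisons between copies of the same \<open>G i\<close> survive, and these form the criterion
  for \<open>copies (m i) (G i)\<close>.\<close>

lemma distinguishing_union_copies_iff:
  assumes simple: "\<And>i. i \<in> I \<Longrightarrow> pair_graph (G i)"
    and conn: "\<And>i. i \<in> I \<Longrightarrow> Digraph_Component.connected (with_proj (G i))"
    and non_iso: "\<And>i j. i \<in> I \<Longrightarrow> j \<in> I \<Longrightarrow> i \<noteq> j \<Longrightarrow>
      \<not> digraph_iso (with_proj (G i)) (with_proj (G j))"
  shows "distinguishing (disjoint_union I (\<lambda>i. copies (m i) (G i))) c \<longleftrightarrow>
    (\<forall>i\<in>I. distinguishing (copies (m i) (G i)) (\<lambda>x. c (i, x)))"
proof -
  let ?D = "\<lambda>i j. distinguishing (G i) (\<lambda>v. c (i, j, v))"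
  let ?E = "\<lambda>i j i' j'. colour_isomorphic (G i) (\<lambda>v. c (i, j, v)) (G i') (\<lambda>v. c (i', j', v))"
  have non_iso': "\<not> ?E i j i' j'" if "i \<in> I" "i' \<in> I" "i \<noteq> i'" for i i' j j'
    using non_iso[OF that] graph_iso_imp_digraph_iso[OF simple simple] that
    by (auto simp: colour_isomorphic_def)
  have "distinguishing (disjoint_union I (\<lambda>i. copies (m i) (G i))) c \<longleftrightarrow>
      (\<forall>(i, j)\<in>SIGMA i:I. {..<m i}. ?D i j) \<and>
      (\<forall>(i, j)\<in>SIGMA i:I. {..<m i}. \<forall>(i', j')\<in>SIGMA i:I. {..<m i}. (i, j) \<noteq> (i', j') \<longrightarrow>
        \<not> ?E i j i' j')"
    using component_decomposition.distinguishing_iff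
      [OF component_decomposition_union_copies[of I G m], OF conn, of c]
    by (simp add: comp_def split_def)
  also have "\<dots> \<longleftrightarrow>
      (\<forall>i\<in>I. (\<forall>j<m i. ?D i j) \<and> (\<forall>j<m i. \<forall>j'<m i. j \<noteq> j' \<longrightarrow> \<not> ?E i j i j'))"
    using non_iso' by (simp add: Ball_def split_paired_All) blast
  also have "\<dots> \<longleftrightarrow> (\<forall>i\<in>I. distinguishing (copies (m i) (G i)) (\<lambda>x. c (i, x)))"
    by (intro ball_cong refl) (rule distinguishing_copies_iff[OF conn, symmetric])
  finally show ?thesis .
qed

section \<open>Counting colourings of a disjoint union\<close>

lemma bij_betw_curry_PiE:
  "bij_betw (\<lambda>c. \<lambda>i\<in>I. \<lambda>v\<in>V i. c (i, v)) ((SIGMA i:I. V i) \<rightarrow>\<^sub>E B) (\<Pi>\<^sub>E i\<in>I. V i \<rightarrow>\<^sub>E B)"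
\<comment> \<open>Currying and uncurrying are restricted at each level, so that they are mutually
  inverse on extensional functions.\<close>
proof (rule bij_betw_byWitness[where f' = "\<lambda>F. \<lambda>p\<in>(SIGMA i:I. V i). F (fst p) (snd p)"])
  show "\<forall>c\<in>(SIGMA i:I. V i) \<rightarrow>\<^sub>E B.
      (\<lambda>p\<in>(SIGMA i:I. V i). (\<lambda>i\<in>I. \<lambda>v\<in>V i. c (i, v)) (fst p) (snd p)) = c"
    by (auto simp: fun_eq_iff PiE_def extensional_def restrict_def)
  show "\<forall>F\<in>(\<Pi>\<^sub>E i\<in>I. V i \<rightarrow>\<^sub>E B).
      (\<lambda>i\<in>I. \<lambda>v\<in>V i. (\<lambda>p\<in>(SIGMA i:I. V i). F (fst p) (snd p)) (i, v)) = F"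
    by (auto simp: fun_eq_iff PiE_def Pi_def extensional_def restrict_def)
qed (auto simp: PiE_def Pi_def)

lemma card_curry_PiE:
  assumes "\<And>c. c \<in> (SIGMA i:I. V i) \<rightarrow>\<^sub>E B \<Longrightarrow> P c \<longleftrightarrow> Q (\<lambda>i\<in>I. \<lambda>v\<in>V i. c (i, v))"
  shows "card {c \<in> (SIGMA i:I. V i) \<rightarrow>\<^sub>E B. P c} = card {F \<in> \<Pi>\<^sub>E i\<in>I. V i \<rightarrow>\<^sub>E B. Q F}"
proof -
  let ?f = "\<lambda>c. \<lambda>i\<in>I. \<lambda>v\<in>V i. c (i, v)"
  have b: "bij_betw ?f ((SIGMA i:I. V i) \<rightarrow>\<^sub>E B) (\<Pi>\<^sub>E i\<in>I. V i \<rightarrow>\<^sub>E B)"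
    by (rule bij_betw_curry_PiE)
  have "?f ` {c \<in> (SIGMA i:I. V i) \<rightarrow>\<^sub>E B. P c} = {F \<in> \<Pi>\<^sub>E i\<in>I. V i \<rightarrow>\<^sub>E B. Q F}"
    (is "?f ` ?A = ?B")
  proof -
    have "?A = {c \<in> (SIGMA i:I. V i) \<rightarrow>\<^sub>E B. Q (?f c)}" using assms by blast
    then have "?f ` ?A = {F \<in> ?f ` ((SIGMA i:I. V i) \<rightarrow>\<^sub>E B). Q F}" by blast
    then show ?thesis unfolding bij_betw_imp_surj_on[OF b] .
  qed
  then show ?thesis
    by (intro bij_betw_same_card[of ?f] bij_betw_subset[OF b]) auto
qed

text \<open>When distinguishing is decided separately on each \<open>K i\<close>, currying turns the
  set counted into a product of the sets counted for the \<open>K i\<close>.\<close>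

lemma dist_poly_disjoint_union:
  assumes "finite I"
    and dist: "\<And>c :: _ \<Rightarrow> nat. distinguishing (disjoint_union I K) c \<longleftrightarrow>
      (\<forall>i\<in>I. distinguishing (K i) (\<lambda>v. c (i, v)))"
  shows "dist_poly k (disjoint_union I K) = (\<Prod>i\<in>I. dist_poly k (K i))"
proof -
  have "dist_poly k (disjoint_union I K) =
      card {F \<in> \<Pi>\<^sub>E i\<in>I. pverts (K i) \<rightarrow>\<^sub>E {1..k}. \<forall>i\<in>I. distinguishing (K i) (F i)}"
    unfolding dist_poly_def pverts_disjoint_union
  proof (rule card_curry_PiE)
    fix c :: "_ \<Rightarrow> nat"
    show "distinguishing (disjoint_union I K) c \<longleftrightarrow>
        (\<forall>i\<in>I. distinguishing (K i) ((\<lambda>i\<in>I. \<lambda>v\<in>pverts (K i). c (i, v)) i))"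
      unfolding dist by (intro ball_cong refl distinguishing_cong) simp
  qed
  also have "{F \<in> \<Pi>\<^sub>E i\<in>I. pverts (K i) \<rightarrow>\<^sub>E {1..k}. \<forall>i\<in>I. distinguishing (K i) (F i)} =
      (\<Pi>\<^sub>E i\<in>I. {c \<in> pverts (K i) \<rightarrow>\<^sub>E {1..k}. distinguishing (K i) c})"
    by (rule set_eqI) (unfold PiE_iff[where I = I] mem_Collect_eq, blast)
  also have "card \<dots> = (\<Prod>i\<in>I. dist_poly k (K i))"
    unfolding dist_poly_def by (rule card_PiE[OF assms(1)])
  finally show ?thesis .
qed

section \<open>Counting tuples of pairwise inequivalent colourings\<close>

text \<open>Induction on \<open>m\<close>: the first \<open>m\<close> entries occupy
  \<open>m\<close> disjoint classes of size \<open>a\<close>, and the last entry must avoid them.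
  Over the integers this also covers \<open>m\<close> beyond the number of classes, where later
  factors may be negative but both sides vanish.\<close>

lemma card_nonequivalent_tuples:
  assumes S: "finite S" and r: "equiv S r" and a: "\<And>x. x \<in> S \<Longrightarrow> card (r `` {x}) = a"
  shows "int (card {f \<in> {..<m} \<rightarrow>\<^sub>E S. \<forall>i<m. \<forall>j<m. i \<noteq> j \<longrightarrow> (f i, f j) \<notin> r})
    = (\<Prod>j<m. int (card S) - int j * int a)"
proof (induction m)
  case 0
  then show ?case by simp
next
  case (Suc m)
  define T where "T n = {f \<in> {..<n} \<rightarrow>\<^sub>E S. \<forall>i<n. \<forall>j<n. i \<noteq> j \<longrightarrow> (f i, f j) \<notin> r}" for n :: nat
  define C where "C f = S - (\<Union>j<m. r `` {f j})" for f :: "nat \<Rightarrow> 'a"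
  have sub: "r `` {x} \<subseteq> S" for x using r by (auto simp: equiv_def refl_on_def)
  have symr: "(x, y) \<in> r \<longleftrightarrow> (y, x) \<in> r" for x y using r by (auto simp: equiv_def sym_def)
  have finT: "finite (T m)" unfolding T_def using S by (simp add: finite_PiE)
  \<comment> \<open>\<open>C f\<close> holds the admissible values for one further entry. The
    existence of \<open>f\<close> gives \<open>m * a \<le> card S\<close>, so the subtraction is
    exact; if \<open>T m\<close> is empty nothing is claimed.\<close>
  have cardC: "int (card (C f)) = int (card S) - int m * int a" if f: "f \<in> T m" for f
  proof -
    have fS: "f j \<in> S" if "j < m" for j using f that by (auto simp: T_def)
    have "card (\<Union>j<m. r `` {f j}) = (\<Sum>j<m. card (r `` {f j}))"
    proof (rule card_UN_disjoint)
      show "\<forall>j\<in>{..<m}. finite (r `` {f j})" using finite_subset[OF sub S] by simp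
      show "\<forall>i\<in>{..<m}. \<forall>j\<in>{..<m}. i \<noteq> j \<longrightarrow> r `` {f i} \<inter> r `` {f j} = {}"
      proof (intro ballI impI equals0I)
        fix i j x
        assume ij: "i \<in> {..<m}" "j \<in> {..<m}" "i \<noteq> j" and "x \<in> r `` {f i} \<inter> r `` {f j}"
        then have "(f i, x) \<in> r" "(x, f j) \<in> r" using symr by auto
        then have "(f i, f j) \<in> r" using r by (meson equivE transE)
        then show False using ij f by (simp add: T_def)
      qed
    qed simp
    also have "\<dots> = m * a" using a fS by simp
    finally have U: "card (\<Union>j<m. r `` {f j}) = m * a" .
    have le: "(\<Union>j<m. r `` {f j}) \<subseteq> S" using sub by blast
    have "card (C f) = card S - m * a"
      unfolding C_def U[symmetric] by (rule card_Diff_subset[OF finite_subset[OF le S] le])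
    moreover have "m * a \<le> card S" using card_mono[OF S le] U by simp
    ultimately show ?thesis by (simp add: of_nat_diff)
  qed
  \<comment> \<open>A tuple of length \<open>Suc m\<close> is a tuple of length \<open>m\<close>
    with an admissible last entry. The inverse restricts to \<open>{..<m}\<close>, which makes
    position \<open>m\<close> undefined again.\<close>
  have "bij_betw (\<lambda>(f, x). f(m := x)) (SIGMA f:T m. C f) (T (Suc m))"
  proof (rule bij_betw_byWitness[where f' = "\<lambda>f. (restrict f {..<m}, f m)"])
    show "\<forall>p\<in>SIGMA f:T m. C f.
        (restrict ((\<lambda>(f, x). f(m := x)) p) {..<m}, ((\<lambda>(f, x). f(m := x)) p) m) = p"
      by (auto simp: T_def fun_eq_iff restrict_def PiE_def extensional_def)
    show "\<forall>f\<in>T (Suc m). (\<lambda>(f, x). f(m := x)) (restrict f {..<m}, f m) = f"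
      by (auto simp: T_def fun_eq_iff restrict_def PiE_def extensional_def)
    show "(\<lambda>(f, x). f(m := x)) ` (SIGMA f:T m. C f) \<subseteq> T (Suc m)"
    proof clarify
      fix f x assume f: "f \<in> T m" and x: "x \<in> C f"
      have "f(m := x) \<in> {..<Suc m} \<rightarrow>\<^sub>E S"
        using f x by (auto simp: T_def C_def PiE_def Pi_def extensional_def)
      moreover have "((f(m := x)) i, (f(m := x)) j) \<notin> r"
        if "i < Suc m" "j < Suc m" "i \<noteq> j" for i j
        using f x that symr by (cases "i = m"; cases "j = m"; auto simp: T_def C_def)
      ultimately show "f(m := x) \<in> T (Suc m)" by (simp add: T_def)
    qed
    show "(\<lambda>f. (restrict f {..<m}, f m)) ` T (Suc m) \<subseteq> (SIGMA f:T m. C f)"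
      by (auto simp: T_def C_def PiE_def Pi_def)
  qed
  then have "card (T (Suc m)) = card (SIGMA f:T m. C f)"
    by (simp add: bij_betw_same_card)
  also have "\<dots> = (\<Sum>f\<in>T m. card (C f))"
    using finT S by (simp add: C_def)
  finally have "int (card (T (Suc m))) = (\<Sum>f\<in>T m. int (card (C f)))" by simp
  also have "\<dots> = int (card (T m)) * (int (card S) - int m * int a)"
    using cardC by simp
  finally show ?case using Suc.IH by (simp add: T_def)
qed

lemma equiv_colour_isomorphic: "equiv S {(c, d) \<in> S \<times> S. colour_isomorphic G c G d}"
  by (rule equivI)
    (auto simp: refl_on_def sym_def trans_def intro: colour_isomorphic_refl
      colour_isomorphic_sym colour_isomorphic_trans)

text \<open>The class of \<open>c\<close> is its orbit under \<open>f \<mapsto> c \<circ> f\<close>,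
  and a distinguishing \<open>c\<close> has trivial stabiliser, so this map is a bijection from the
  automorphisms onto the class.\<close>

lemma card_colour_isomorphism_class:
  assumes c: "c \<in> pverts G \<rightarrow>\<^sub>E B" "distinguishing G c"
  shows "card {d \<in> pverts G \<rightarrow>\<^sub>E B. distinguishing G d \<and> colour_isomorphic G c G d}
    = card (automorphisms G)"
proof -
  let ?V = "pverts G"
  let ?t = "\<lambda>f. restrict (c \<circ> f) ?V"
  \<comment> \<open>The global inverse \<open>inv f\<close> agrees on vertices with
    \<open>inv_into ?V f\<close>, for which the isomorphism property is known.\<close>
  have inv_mem: "graph_iso (inv f) G G" if "f \<in> automorphisms G" for f
  proof -
    have "inv_into ?V f v = inv f v" if "v \<in> ?V" for v
      using \<open>f \<in> automorphisms G\<close> that unfolding automorphism_iff graph_iso_def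
      by (metis bij_betw_def f_inv_into_f inv_f_f inv_into_into permutes_inj)
    moreover have "bij_betw (inv f) ?V ?V"
      using that permutes_imp_bij[OF permutes_inv] unfolding automorphism_iff by blast
    ultimately show ?thesis
      using graph_iso_inv_into[of f G G] that by (simp add: automorphism_iff graph_iso_def)
  qed
  have "inj_on ?t (automorphisms G)"
  proof (rule inj_onI)
    fix f h
    assume f: "f \<in> automorphisms G" and h: "h \<in> automorphisms G" and eq: "?t f = ?t h"
    have fh: "c (f v) = c (h v)" if "v \<in> ?V" for v
      using fun_cong[OF eq, of v] that by simp
    have per: "f permutes ?V" "h permutes ?V" using f h by (auto simp: automorphism_iff)
    \<comment> \<open>If \<open>c \<circ> f\<close> and \<open>c \<circ> h\<close> agree on
      vertices, then \<open>f \<circ> inv h\<close> preserves \<open>c\<close> and is therefore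
      trivial.\<close>
    have "graph_iso (f \<circ> inv h) G G"
      using graph_iso_comp inv_mem[OF h] f by (auto simp: automorphism_iff)
    moreover have "\<forall>v\<in>?V. c ((f \<circ> inv h) v) = c v"
      using fh per by (simp add: permutes_in_image permutes_inv permutes_inverses)
    ultimately have "\<forall>v\<in>?V. (f \<circ> inv h) v = v"
      using c(2) unfolding distinguishing_iff_graph_iso by blast
    then have fix_V: "\<forall>v\<in>?V. f (inv h v) = v" by simp
    have "f v = h v" for v
    proof (cases "v \<in> ?V")
      case True
      then have "f (inv h (h v)) = h v" using fix_V per by (simp add: permutes_in_image)
      then show ?thesis using per by (simp add: permutes_inverses)
    next
      case False
      then show ?thesis using per by (simp add: permutes_not_in)
    qed
    then show "f = h" by blast
  qed
  moreover have "?t ` automorphisms G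
      = {d \<in> ?V \<rightarrow>\<^sub>E B. distinguishing G d \<and> colour_isomorphic G c G d}" (is "_ = ?C")
  proof (intro equalityI subsetI)
    fix d assume "d \<in> ?t ` automorphisms G"
    then obtain f where f: "f \<in> automorphisms G" and d: "d = ?t f" by blast
    have iso: "colour_isomorphic G d G c"
      using f d by (auto simp: colour_isomorphic_def automorphism_iff)
    have "d \<in> ?V \<rightarrow>\<^sub>E B"
      using c(1) d f graph_iso_in_pverts[of f G G] by (auto simp: automorphism_iff PiE_iff)
    then show "d \<in> ?C"
      using iso colour_isomorphic_distinguishing[OF iso c(2)] colour_isomorphic_sym[OF iso] by blast
  next
    \<comment> \<open>Surjectivity: a colour isomorphism from \<open>d\<close> to \<open>c\<close>,
      extended to an automorphism \<open>f\<close>, exhibits \<open>d\<close> as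
      \<open>c \<circ> f\<close> on vertices.\<close>
    fix d assume d: "d \<in> ?C"
    then obtain g where g: "graph_iso g G G" "\<forall>v\<in>?V. c (g v) = d v"
      using colour_isomorphic_sym unfolding colour_isomorphic_def by blast
    obtain f where f: "f \<in> automorphisms G" "\<And>v. v \<in> ?V \<Longrightarrow> f v = g v"
      using graph_iso_extends_to_automorphism[OF g(1)] by blast
    have "d = ?t f"
      using d f(2) g(2) by (auto simp: fun_eq_iff PiE_iff extensional_def restrict_def)
    then show "d \<in> ?t ` automorphisms G" using f(1) by blast
  qed
  ultimately show ?thesis using card_image by fastforce
qed

text \<open>A colouring of the copies is a tuple of colourings of \<open>G\<close>; it is
  distinguishing when the entries are distinguishing and pairwise inequivalent. The tuple count
  applies with classes of size \<open>card (automorphisms G)\<close>.\<close>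

lemma dist_poly_copies:
  assumes fin: "finite (pverts G)" and conn: "Digraph_Component.connected (with_proj G)"
  shows "int (dist_poly k (copies m G)) =
    (\<Prod>j<m. int (dist_poly k G) - int j * int (card (automorphisms G)))"
proof -
  let ?V = "pverts G"
  let ?D = "{c \<in> ?V \<rightarrow>\<^sub>E {1..k}. distinguishing G c}"
  let ?r = "{(c, d) \<in> ?D \<times> ?D. colour_isomorphic G c G d}"
  let ?Q = "\<lambda>F. (\<forall>j<m. distinguishing G (F j)) \<and>
    (\<forall>i<m. \<forall>j<m. i \<noteq> j \<longrightarrow> \<not> colour_isomorphic G (F i) G (F j))"
  have "dist_poly k (copies m G) = card {F \<in> {..<m} \<rightarrow>\<^sub>E (?V \<rightarrow>\<^sub>E {1..k}). ?Q F}"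
    unfolding dist_poly_def copies_def pverts_disjoint_union
  proof (rule card_curry_PiE, fold copies_def)
    fix c :: "nat \<times> 'a \<Rightarrow> nat"
    let ?F = "\<lambda>j\<in>{..<m}. \<lambda>v\<in>?V. c (j, v)"
    have "distinguishing G (\<lambda>v. c (j, v)) \<longleftrightarrow> distinguishing G (?F j)" if "j < m" for j
      using that by (intro distinguishing_cong) simp
    moreover have "colour_isomorphic G (\<lambda>v. c (i, v)) G (\<lambda>v. c (j, v)) \<longleftrightarrow>
        colour_isomorphic G (?F i) G (?F j)" if "i < m" "j < m" for i j
      using that by (intro colour_isomorphic_cong) simp_all
    ultimately show "distinguishing (copies m G) c \<longleftrightarrow> ?Q ?F"
      unfolding distinguishing_copies_iff[OF conn] by blast
  qed
  \<comment> \<open>Being distinguishing moves into the codomain \<open>?D\<close>; on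
    \<open>?D\<close> colour isomorphism is the relation \<open>?r\<close>.\<close>
  also have "{F \<in> {..<m} \<rightarrow>\<^sub>E (?V \<rightarrow>\<^sub>E {1..k}). ?Q F} =
      {F \<in> {..<m} \<rightarrow>\<^sub>E ?D. \<forall>i<m. \<forall>j<m. i \<noteq> j \<longrightarrow> (F i, F j) \<notin> ?r}"
    by (rule set_eqI) (unfold PiE_iff[where I = "{..<m}"] mem_Collect_eq, blast)
  finally have *: "dist_poly k (copies m G) =
      card {F \<in> {..<m} \<rightarrow>\<^sub>E ?D. \<forall>i<m. \<forall>j<m. i \<noteq> j \<longrightarrow> (F i, F j) \<notin> ?r}" .
  have class_card: "card (?r `` {c}) = card (automorphisms G)" if "c \<in> ?D" for c
  proof -
    have "?r `` {c} = {d \<in> ?V \<rightarrow>\<^sub>E {1..k}. distinguishing G d \<and> colour_isomorphic G c G d}"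
      using that by blast
    then show ?thesis using card_colour_isomorphism_class[of c G "{1..k}"] that by simp
  qed
  have "finite ?D" using fin by (simp add: finite_PiE)
  then show ?thesis
    unfolding * unfolding dist_poly_def
    by (rule card_nonequivalent_tuples[OF _ equiv_colour_isomorphic]) (rule class_card)
qed

theorem theorem3p4:
  fixes G :: "nat \<Rightarrow> 'a pair_pre_digraph" and m :: "nat \<Rightarrow> nat" and t k :: nat
  assumes simple: "\<And>i. i \<in> {1..t} \<Longrightarrow> pair_graph (G i)"
    and conn: "\<And>i. i \<in> {1..t} \<Longrightarrow> Digraph_Component.connected (with_proj (G i))"
    and non_iso: "\<And>i j. i \<in> {1..t} \<Longrightarrow> j \<in> {1..t} \<Longrightarrow> i \<noteq> j \<Longrightarrow>
      \<not> digraph_iso (with_proj (G i)) (with_proj (G j))"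
    and m_pos: "\<And>i. i \<in> {1..t} \<Longrightarrow> 0 < m i"
  shows "int (dist_poly k (disjoint_union {1..t} (\<lambda>i. copies (m i) (G i))))
           = (\<Prod>i=1..t. int (dist_poly k (copies (m i) (G i))))
       \<and> (\<Prod>i=1..t. int (dist_poly k (copies (m i) (G i))))
           = (\<Prod>i=1..t. \<Prod>j<m i. (int (dist_poly k (G i)) - int j * int (card (automorphisms (G i)))))"
proof
  have "dist_poly k (disjoint_union {1..t} (\<lambda>i. copies (m i) (G i)))
      = (\<Prod>i\<in>{1..t}. dist_poly k (copies (m i) (G i)))"
    by (rule dist_poly_disjoint_union, simp)
      (rule distinguishing_union_copies_iff[OF simple conn non_iso])
  then show "int (dist_poly k (disjoint_union {1..t} (\<lambda>i. copies (m i) (G i))))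
      = (\<Prod>i=1..t. int (dist_poly k (copies (m i) (G i))))"
    by simp
  have "finite (pverts (G i))" if "i \<in> {1..t}" for i
    using simple[OF that] by (simp add: pair_graph_def pair_digraph_def pair_fin_digraph.pair_finite_verts)
  then show "(\<Prod>i=1..t. int (dist_poly k (copies (m i) (G i))))
      = (\<Prod>i=1..t. \<Prod>j<m i. (int (dist_poly k (G i)) - int j * int (card (automorphisms (G i)))))"
    using dist_poly_copies conn by (intro prod.cong refl) blast
qed

end
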